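(* Let $r\ge 1$ and let $f_1,\dots,f_r\colon X\to Y$ and $g_1,\dots,g_r\colon \widetilde{X}\to\widetilde{Y}$ be fibrewise maps over $B$. If $X\times_B\widetilde{X}$ is a normal space, then $$D_B(f_1\times_B g_1,\dots,f_r\times_B g_r)\le D_B(f_1,\dots,f_r)+D_B(g_1,\dots,g_r).$$
   Context: All spaces are topological spaces, all maps are continuous, $I=[0,1]$. A fibrewise space over $B$ is a space $X$ with a map $p_X\colon X\to B$; a fibrewise map $f\colon X\to Y$ satisfies $p_Y\circ f=p_X$. Subspaces are fibrewise by restriction. $f\simeq_B g$ means there is $H\colon X\times I\to Y$ with $p_Y(H(x,t))=p_X(x)$, $H(\cdot,0)=f$, $H(\cdot,1)=g$. $X\times_B\widetilde X=\{(x,y)\in X\times \widetilde X\mid p_X(x)=p_{\widetilde X}(y)\}$ is the fibrewise product, and $f\times_B g\colon X\times_B\widetilde X\to Y\times_B\widetilde Y$ is $(x,y)\mapsto (f(x),g(y))$. For fibrewise maps $f_1,\dots,f_r\colon X\to Y$, $D_B(f_1,\dots,f_r)$ is the least $n\ge 0$ (or $\infty$) such that $X$ has an open cover $\{U_0,\dots,U_n\}$ with $f_s|_{U_i}\simeq_B f_t|_{U_i}$ for all $0\le i\le n$, $1\le s,t\le r$. *)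

theory Defs
  imports "HOL-Analysis.Analysis" "HOL-Library.Extended_Nat"
begin

definition fibrewise_space :: "'b topology \<Rightarrow> 'a topology \<Rightarrow> ('a \<Rightarrow> 'b) \<Rightarrow> bool" where
  "fibrewise_space B X p \<longleftrightarrow> continuous_map X B p"

definition fibrewise_map ::
  "'a topology \<Rightarrow> ('a \<Rightarrow> 'b) \<Rightarrow> 'c topology \<Rightarrow> ('c \<Rightarrow> 'b) \<Rightarrow> ('a \<Rightarrow> 'c) \<Rightarrow> bool" where
  "fibrewise_map X pX Y pY f \<longleftrightarrow>
     continuous_map X Y f \<and> (\<forall>x\<in>topspace X. pY (f x) = pX x)"

text \<open>The side condition makes every stage \<open>H(\<cdot>, t)\<close> of the homotopy lie over the base. The topology
  of the base plays no role here, so it is not an argument.\<close>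

definition fibrewise_homotopic ::
  "'a topology \<Rightarrow> ('a \<Rightarrow> 'b) \<Rightarrow> 'c topology \<Rightarrow> ('c \<Rightarrow> 'b) \<Rightarrow> ('a \<Rightarrow> 'c) \<Rightarrow> ('a \<Rightarrow> 'c) \<Rightarrow> bool" where
  "fibrewise_homotopic X pX Y pY f g \<longleftrightarrow>
     homotopic_with (\<lambda>h. \<forall>x\<in>topspace X. pY (h x) = pX x) X Y f g"

text \<open>\<^const>\<open>homotopic_with\<close> prescribes the ends of the homotopy on the whole type; as the following
  shows, only their values on the space matter.\<close>

lemma fibrewise_homotopic_iff:
  "fibrewise_homotopic X pX Y pY f g \<longleftrightarrow>
     (\<exists>H. continuous_map (prod_topology (top_of_set {0..1::real}) X) Y H \<and>
          (\<forall>x\<in>topspace X. H (0, x) = f x) \<and>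
          (\<forall>x\<in>topspace X. H (1, x) = g x) \<and>
          (\<forall>t\<in>{0..1}. \<forall>x\<in>topspace X. pY (H (t, x)) = pX x))"
  unfolding fibrewise_homotopic_def by (subst homotopic_with) auto

definition fibrewise_product ::
  "'a topology \<Rightarrow> ('a \<Rightarrow> 'b) \<Rightarrow> 'c topology \<Rightarrow> ('c \<Rightarrow> 'b) \<Rightarrow> ('a \<times> 'c) topology" where
  "fibrewise_product X pX X' pX' =
     subtopology (prod_topology X X') {(x, y). pX x = pX' y}"

definition fibrewise_product_proj :: "('a \<Rightarrow> 'b) \<Rightarrow> 'a \<times> 'c \<Rightarrow> 'b" where
  "fibrewise_product_proj pX = (\<lambda>(x, y). pX x)"

definition fibrewise_homotopic_cover ::
  "'a topology \<Rightarrow> ('a \<Rightarrow> 'b) \<Rightarrow> 'c topology \<Rightarrow> ('c \<Rightarrow> 'b) \<Rightarrow>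
   nat \<Rightarrow> (nat \<Rightarrow> 'a \<Rightarrow> 'c) \<Rightarrow> nat \<Rightarrow> (nat \<Rightarrow> 'a set) \<Rightarrow> bool" where
  "fibrewise_homotopic_cover X pX Y pY r f n U \<longleftrightarrow>
     (\<forall>i\<le>n. openin X (U i)) \<and> (\<Union>i\<le>n. U i) = topspace X \<and>
     (\<forall>i\<le>n. \<forall>s\<in>{1..r}. \<forall>t\<in>{1..r}.
        fibrewise_homotopic (subtopology X (U i)) pX Y pY (f s) (f t))"

text \<open>The distance of \<open>f 1, \<dots>, f r\<close>; the infimum over the empty set is \<open>\<infinity>\<close>.\<close>

definition fibrewise_distance ::
  "'a topology \<Rightarrow> ('a \<Rightarrow> 'b) \<Rightarrow> 'c topology \<Rightarrow> ('c \<Rightarrow> 'b) \<Rightarrow>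
   nat \<Rightarrow> (nat \<Rightarrow> 'a \<Rightarrow> 'c) \<Rightarrow> enat" where
  "fibrewise_distance X pX Y pY r f =
     Inf {enat n | n. \<exists>U. fibrewise_homotopic_cover X pX Y pY r f n U}"

end

theory Submission
  imports Defs
begin

text \<open>
  If \<open>f 1, \<dots>, f r\<close> become homotopic on the members of a cover of \<open>X\<close> by \<open>n + 1\<close> open sets, and
  \<open>g 1, \<dots>, g r\<close> on those of a cover of \<open>X'\<close> by \<open>m + 1\<close> open sets, then the products become
  homotopic on every intersection of preimages in \<open>Z = X \<times>\<^sub>B X'\<close>: the two homotopies lie over the
  same point of \<open>B\<close>, hence they pair to a map into \<open>Y \<times>\<^sub>B Y'\<close>. Taking all intersections
  gives a cover with \<open>(n + 1) * (m + 1)\<close> members; only \<open>n + m + 1\<close> are wanted.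

  The remedy is to lengthen both covers of \<open>Z\<close> to \<open>n + m + 1\<close> members, with such redundancy that
  pairing equal indices suffices. In the lengthened first cover \<open>A 0, \<dots>, A (n + m)\<close> each point lies
  in at least \<open>m + 1\<close> members, in the lengthened second cover \<open>C 0, \<dots>, C (n + m)\<close> in at least
  \<open>n + 1\<close>. As \<open>(m + 1) + (n + 1)\<close> exceeds the number of indices, each point has an index \<open>i\<close>
  with \<open>z \<in> A i \<inter> C i\<close>, so the sets \<open>A i \<inter> C i\<close> cover \<open>Z\<close>.

  The lengthening (\<open>normal_space_cover_extend\<close>) is where normality enters. Each new member is a
  disjoint union of open subsets of old members, and on such a union homotopies can be glued
  (\<open>fibrewise_homotopic_disjoint_union\<close>).
\<close>

section \<open>Redundant covers of normal spaces\<close>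

text \<open>
  Each member is separated from the union of the others; cutting its neighbourhood down by the sets
  that protect the others makes the neighbourhoods disjoint.
\<close>

lemma normal_space_separate_finite_family:
  assumes "normal_space Z" and "finite I"
    and closed: "\<And>i. i \<in> I \<Longrightarrow> closedin Z (E i)"
    and disj: "disjoint_family_on E I"
  obtains G where "\<And>i. i \<in> I \<Longrightarrow> openin Z (G i)" and "\<And>i. i \<in> I \<Longrightarrow> E i \<subseteq> G i"
    and "disjoint_family_on G I"
proof -
  have "\<exists>U V. openin Z U \<and> openin Z V \<and> E i \<subseteq> U \<and> (\<Union>j\<in>I - {i}. E j) \<subseteq> V \<and> disjnt U V"
    if "i \<in> I" for i
  proof -
    have "closedin Z (\<Union>j\<in>I - {i}. E j)"
      using assms by (intro closedin_Union) auto
    moreover have "disjnt (E i) (\<Union>j\<in>I - {i}. E j)"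
      using disj that by (auto simp: disjnt_def disjoint_family_on_def)
    ultimately show ?thesis
      using \<open>normal_space Z\<close> closed[OF that] unfolding normal_space_def by blast
  qed
  then obtain U V where UV: "\<And>i. i \<in> I \<Longrightarrow> openin Z (U i)" "\<And>i. i \<in> I \<Longrightarrow> openin Z (V i)"
    "\<And>i. i \<in> I \<Longrightarrow> E i \<subseteq> U i" "\<And>i. i \<in> I \<Longrightarrow> (\<Union>j\<in>I - {i}. E j) \<subseteq> V i"
    "\<And>i. i \<in> I \<Longrightarrow> disjnt (U i) (V i)"
    by metis
  \<comment> \<open>The whole space is among the intersected sets because \<open>I - {i}\<close> may be empty.\<close>
  define G where "G i = U i \<inter> \<Inter> (insert (topspace Z) (V ` (I - {i})))" for i
  show thesis
  proof
    show "openin Z (G i)" if "i \<in> I" for i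
      unfolding G_def using UV that \<open>finite I\<close> by (intro openin_Int openin_Inter) auto
    show "E i \<subseteq> G i" if "i \<in> I" for i
      unfolding G_def using UV(3,4) closedin_subset[OF closed] that by blast
    show "disjoint_family_on G I"
      unfolding disjoint_family_on_def
    proof (intro ballI impI)
      fix i j assume "i \<in> I" "j \<in> I" "i \<noteq> j"
      then have "G i \<subseteq> U i" "G j \<subseteq> V i"
        by (auto simp: G_def)
      then show "G i \<inter> G j = {}"
        using UV(5)[OF \<open>i \<in> I\<close>] by (auto simp: disjnt_def)
    qed
  qed
qed

text \<open>
  One member is added at a time. Suppose every point lies in at least \<open>m + 1\<close> members. The points
  lying in exactly \<open>m + 1\<close> of them fall into classes \<open>E S\<close> according to the set \<open>S\<close> of their
  indices. Because no point has fewer indices, \<open>E S\<close> is just the set of points avoiding all members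
  outside \<open>S\<close>, and so it is closed; distinct classes are disjoint. By normality the
  classes have disjoint open neighbourhoods, and within the members indexed by \<open>S\<close> these make up the
  new member, which raises the count of every point that needs it.

  The property \<open>P\<close> stands for any condition that passes to subsets and to disjoint unions of
  open sets. The unions are indexed by sets of naturals since the sets \<open>S\<close> serve as indices.
\<close>

lemma normal_space_cover_extend:
  fixes P :: "'z set \<Rightarrow> bool" and A :: "nat \<Rightarrow> 'z set"
  assumes "normal_space Z"
    and mono: "\<And>U W. P U \<Longrightarrow> W \<subseteq> U \<Longrightarrow> P W"
    and glue: "\<And>(I :: nat set set) W. (\<And>S. S \<in> I \<Longrightarrow> openin Z (W S)) \<Longrightarrow> (\<And>S. S \<in> I \<Longrightarrow> P (W S)) \<Longrightarrow>
                 disjoint_family_on W I \<Longrightarrow> P (\<Union>S\<in>I. W S)"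
    and "\<And>i. i \<le> n \<Longrightarrow> openin Z (A i)" and "\<And>i. i \<le> n \<Longrightarrow> P (A i)"
    and "(\<Union>i\<le>n. A i) = topspace Z"
  shows "\<exists>A'. (\<forall>i\<le>n + m. openin Z (A' i) \<and> P (A' i)) \<and>
              (\<forall>z\<in>topspace Z. m < card {i. i \<le> n + m \<and> z \<in> A' i})"
proof (induction m)
  case 0
  have "0 < card {i. i \<le> n \<and> z \<in> A i}" if "z \<in> topspace Z" for z
    using that assms(6) by (force simp: card_gt_0_iff)
  then show ?case
    using assms(4,5) by auto
next
  case (Suc m)
  then obtain A' where A': "\<And>i. i \<le> n + m \<Longrightarrow> openin Z (A' i)" "\<And>i. i \<le> n + m \<Longrightarrow> P (A' i)"
    and many: "\<And>z. z \<in> topspace Z \<Longrightarrow> m < card {i. i \<le> n + m \<and> z \<in> A' i}"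
    by blast
  define I where "I = {S. S \<subseteq> {..n + m} \<and> card S = Suc m}"
  define E where "E S = topspace Z - (\<Union>i\<in>{..n + m} - S. A' i)" for S
  have finI: "finite I"
    unfolding I_def by (rule finite_subset[of _ "Pow {..n + m}"]) auto
  have E_eq: "{i. i \<le> n + m \<and> z \<in> A' i} = S" if "S \<in> I" "z \<in> E S" for S z
  proof (rule card_seteq)
    show "finite S" using that finite_subset by (auto simp: I_def)
    show "{i. i \<le> n + m \<and> z \<in> A' i} \<subseteq> S" using that by (auto simp: E_def)
    show "card S \<le> card {i. i \<le> n + m \<and> z \<in> A' i}"
      using many[of z] that by (auto simp: E_def I_def)
  qed
  have "closedin Z (E S)" for S
    unfolding E_def using A' by (intro closedin_diff openin_Union) auto
  moreover have "disjoint_family_on E I"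
    unfolding disjoint_family_on_def using E_eq by blast
  ultimately obtain G where G: "\<And>S. S \<in> I \<Longrightarrow> openin Z (G S)" "\<And>S. S \<in> I \<Longrightarrow> E S \<subseteq> G S"
    "disjoint_family_on G I"
    using normal_space_separate_finite_family[OF \<open>normal_space Z\<close> finI] by metis
  define W where "W S = G S \<inter> (\<Inter>i\<in>S. A' i)" for S
  define N where "N = (\<Union>S\<in>I. W S)"
  have props: "S \<noteq> {}" "finite S" "\<And>i. i \<in> S \<Longrightarrow> i \<le> n + m" if "S \<in> I" for S
    using that finite_subset by (auto simp: I_def)
  have openW: "openin Z (W S)" if "S \<in> I" for S
    unfolding W_def using that props[OF that] G A' by (intro openin_Int openin_INT2) auto
  have "P (W S)" if S: "S \<in> I" for S
  proof -
    obtain i where "i \<in> S" using props(1)[OF S] by blast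
    then have "P (A' i)" and "W S \<subseteq> A' i"
      using A'(2) props(3)[OF S] by (auto simp: W_def)
    then show ?thesis by (rule mono)
  qed
  moreover have "disjoint_family_on W I"
    using G(3) unfolding W_def disjoint_family_on_def by blast
  ultimately have "P N"
    unfolding N_def using glue openW by blast
  have "openin Z N"
    unfolding N_def using openW by blast
  define A'' where "A'' = A'(Suc (n + m) := N)"
  have "Suc m < card {i. i \<le> n + Suc m \<and> z \<in> A'' i}" if z: "z \<in> topspace Z" for z
  proof -
    let ?S = "{i. i \<le> n + m \<and> z \<in> A' i}"
    have fin: "finite {i. i \<le> n + Suc m \<and> z \<in> A'' i}" by simp
    have sub: "?S \<subseteq> {i. i \<le> n + Suc m \<and> z \<in> A'' i}"
      by (auto simp: A''_def)
    show ?thesis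
    proof (cases "card ?S = Suc m")
      case True
      then have "?S \<in> I" by (auto simp: I_def)
      moreover have "z \<in> E ?S" using z by (auto simp: E_def)
      ultimately have "z \<in> N" using G(2) by (fastforce simp: N_def W_def)
      then have "insert (Suc (n + m)) ?S \<subseteq> {i. i \<le> n + Suc m \<and> z \<in> A'' i}"
        by (auto simp: A''_def)
      from card_mono[OF fin this] show ?thesis using True by simp
    next
      case False
      then show ?thesis using many[OF z] card_mono[OF fin sub] by linarith
    qed
  qed
  moreover have "openin Z (A'' i) \<and> P (A'' i)" if "i \<le> n + Suc m" for i
    using A' \<open>P N\<close> \<open>openin Z N\<close> that by (auto simp: A''_def le_Suc_eq)
  ultimately show ?case by blast
qed

section \<open>Fibrewise homotopies on open sets\<close>

lemma fibrewise_homotopic_pullback: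
  assumes "fibrewise_homotopic X p Y q f g" and h: "continuous_map Z X h"
    and "\<And>z. z \<in> topspace Z \<Longrightarrow> p (h z) = p' z"
  shows "fibrewise_homotopic Z p' Y q (f \<circ> h) (g \<circ> h)"
proof -
  obtain H where H: "continuous_map (prod_topology (top_of_set {0..1::real}) X) Y H"
    "\<forall>x\<in>topspace X. H (0, x) = f x" "\<forall>x\<in>topspace X. H (1, x) = g x"
    "\<forall>t\<in>{0..1}. \<forall>x\<in>topspace X. q (H (t, x)) = p x"
    using assms(1) unfolding fibrewise_homotopic_iff by blast
  have inX: "h z \<in> topspace X" if "z \<in> topspace Z" for z
    using h that by (auto simp: continuous_map_def)
  have "continuous_map (prod_topology (top_of_set {0..1::real}) Z)
          (prod_topology (top_of_set {0..1::real}) X) (map_prod id h)"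
    using continuous_map_prod_top[of "top_of_set {0..1::real}" Z "top_of_set {0..1::real}" X id h] h
    by (simp add: map_prod_def)
  from continuous_map_compose[OF this H(1)] show ?thesis
    unfolding fibrewise_homotopic_iff using H(2-4) inX assms(3)
    by (intro exI[of _ "H \<circ> map_prod id h"]) auto
qed

lemma fibrewise_homotopic_subset:
  assumes "fibrewise_homotopic (subtopology Z U) p Y q f g" and "W \<subseteq> U"
  shows "fibrewise_homotopic (subtopology Z W) p Y q f g"
proof -
  have "continuous_map (subtopology Z W) (subtopology Z U) id"
    using assms(2) by (auto simp: continuous_map_in_subtopology continuous_map_from_subtopology)
  from fibrewise_homotopic_pullback[OF assms(1) this, of p] show ?thesis by simp
qed

text \<open>
  The homotopies on the members agree on overlaps for want of overlaps, so they paste along the open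
  cylinders over the members.
\<close>

lemma fibrewise_homotopic_disjoint_union:
  assumes op: "\<And>i. i \<in> I \<Longrightarrow> openin Z (W i)" and disj: "disjoint_family_on W I"
    and hom: "\<And>i. i \<in> I \<Longrightarrow> fibrewise_homotopic (subtopology Z (W i)) p Y q f g"
  shows "fibrewise_homotopic (subtopology Z (\<Union>i\<in>I. W i)) p Y q f g"
proof -
  let ?J = "top_of_set {0..1::real}" and ?V = "\<Union>i\<in>I. W i"
  let ?T = "\<lambda>i. {0..1} \<times> W i" and ?Z = "prod_topology (top_of_set {0..1::real}) (subtopology Z (\<Union>i\<in>I. W i))"
  have sub: "W i \<subseteq> topspace Z" if "i \<in> I" for i
    using openin_subset[OF op[OF that]] .
  obtain H where H: "\<And>i. i \<in> I \<Longrightarrow> continuous_map (prod_topology ?J (subtopology Z (W i))) Y (H i)"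
    "\<And>i x. i \<in> I \<Longrightarrow> x \<in> W i \<Longrightarrow> H i (0, x) = f x"
    "\<And>i x. i \<in> I \<Longrightarrow> x \<in> W i \<Longrightarrow> H i (1, x) = g x"
    "\<And>i t x. i \<in> I \<Longrightarrow> t \<in> {0..1} \<Longrightarrow> x \<in> W i \<Longrightarrow> q (H i (t, x)) = p x"
  proof -
    have "\<forall>i\<in>I. \<exists>H. continuous_map (prod_topology ?J (subtopology Z (W i))) Y H \<and>
      (\<forall>x\<in>W i. H (0, x) = f x) \<and> (\<forall>x\<in>W i. H (1, x) = g x) \<and>
      (\<forall>t\<in>{0..1}. \<forall>x\<in>W i. q (H (t, x)) = p x)"
      using hom sub unfolding fibrewise_homotopic_iff by (simp add: inf.absorb2)
    then obtain H where "\<forall>i\<in>I. continuous_map (prod_topology ?J (subtopology Z (W i))) Y (H i) \<and>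
      (\<forall>x\<in>W i. H i (0, x) = f x) \<and> (\<forall>x\<in>W i. H i (1, x) = g x) \<and>
      (\<forall>t\<in>{0..1}. \<forall>x\<in>W i. q (H i (t, x)) = p x)"
      by (rule bchoice[THEN exE])
    then show thesis
      by (intro that[of H]) blast+
  qed
  have subT: "subtopology ?Z (?T i) = prod_topology ?J (subtopology Z (W i))" if "i \<in> I" for i
  proof -
    have "?V \<inter> W i = W i" using that by blast
    then show ?thesis by (simp add: subtopology_Times subtopology_subtopology)
  qed
  obtain K where contK: "continuous_map ?Z Y K" and pasted:
    "\<And>x i. i \<in> I \<Longrightarrow> x \<in> topspace ?Z \<inter> ?T i \<Longrightarrow> K x = H i x"
  proof (rule pasting_lemma_exists[where X = ?Z and I = I and T = ?T and f = H and Y = Y])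
    show "topspace ?Z \<subseteq> (\<Union>i\<in>I. ?T i)" by auto
    show "openin ?Z (?T i)" if "i \<in> I" for i
    proof -
      have "openin (subtopology Z ?V) (W i)"
        using that op by (auto simp: openin_subtopology)
      then show ?thesis
        by (simp add: openin_prod_Times_iff)
    qed
    show "continuous_map (subtopology ?Z (?T i)) Y (H i)" if "i \<in> I" for i
      using H(1)[OF that] by (simp only: subT[OF that])
    show "H i x = H j x" if "i \<in> I" "j \<in> I" "x \<in> topspace ?Z \<inter> ?T i \<inter> ?T j" for i j x
      using disj that by (cases "i = j") (auto simp: disjoint_family_on_def)
  qed blast
  have K: "K (t, x) = H i (t, x)" if "i \<in> I" "t \<in> {0..1}" "x \<in> W i" for i t x
    using pasted[of i "(t, x)"] that sub[of i] by auto
  show ?thesis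
    unfolding fibrewise_homotopic_iff
    using contK K H by (intro exI[of _ K]) auto
qed

text \<open>
  Homotopies of the two coordinates, both defined on the same part of the fibrewise product, pair to
  one into the fibrewise product of the targets: over \<open>(x, x')\<close> the first stays over \<open>p x\<close> and the
  second over \<open>p' x'\<close>, and these points of the base coincide.
\<close>

lemma fibrewise_homotopic_map_prod:
  assumes f: "fibrewise_homotopic (subtopology (fibrewise_product X p X' p') W) (p \<circ> fst) Y q
                (f \<circ> fst) (f' \<circ> fst)"
    and g: "fibrewise_homotopic (subtopology (fibrewise_product X p X' p') W) (p' \<circ> snd) Y' q'
                (g \<circ> snd) (g' \<circ> snd)"
  shows "fibrewise_homotopic (subtopology (fibrewise_product X p X' p') W)
           (fibrewise_product_proj p) (fibrewise_product Y q Y' q') (fibrewise_product_proj q)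
           (map_prod f g) (map_prod f' g')"
proof -
  let ?Z = "subtopology (fibrewise_product X p X' p') W"
  let ?IZ = "prod_topology (top_of_set {0..1::real}) ?Z"
  obtain H where H: "continuous_map ?IZ Y H"
    "\<forall>x\<in>topspace ?Z. H (0, x) = f (fst x)" "\<forall>x\<in>topspace ?Z. H (1, x) = f' (fst x)"
    "\<forall>t\<in>{0..1}. \<forall>x\<in>topspace ?Z. q (H (t, x)) = p (fst x)"
    using f unfolding fibrewise_homotopic_iff by auto
  obtain K where K: "continuous_map ?IZ Y' K"
    "\<forall>x\<in>topspace ?Z. K (0, x) = g (snd x)" "\<forall>x\<in>topspace ?Z. K (1, x) = g' (snd x)"
    "\<forall>t\<in>{0..1}. \<forall>x\<in>topspace ?Z. q' (K (t, x)) = p' (snd x)"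
    using g unfolding fibrewise_homotopic_iff by auto
  have fib: "p (fst x) = p' (snd x)" if "x \<in> topspace ?Z" for x
    using that by (auto simp: fibrewise_product_def)
  have "continuous_map ?IZ (fibrewise_product Y q Y' q') (\<lambda>x. (H x, K x))"
    unfolding fibrewise_product_def[of Y] continuous_map_in_subtopology
  proof
    show "continuous_map ?IZ (prod_topology Y Y') (\<lambda>x. (H x, K x))"
      using H(1) K(1) by (rule continuous_map_pairedI)
    show "(\<lambda>x. (H x, K x)) \<in> topspace ?IZ \<rightarrow> {(x, y). q x = q' y}"
      using H(4) K(4) fib by (simp add: Pi_iff)
  qed
  then show ?thesis
    unfolding fibrewise_homotopic_iff using H K
    by (intro exI[of _ "\<lambda>x. (H x, K x)"]) (auto simp: fibrewise_product_proj_def)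
qed

section \<open>Subadditivity of the fibrewise distance\<close>

text \<open>
  The cover is pulled back along \<open>h\<close> before it is lengthened, so that normality is asked of \<open>Z\<close>
  alone; in the application \<open>h\<close> is a projection of the fibrewise product.
\<close>

lemma fibrewise_homotopic_cover_extend:
  assumes "normal_space Z" and "fibrewise_homotopic_cover X p Y q r f n U"
    and h: "continuous_map Z X h" and k: "k = n + m"
  shows "\<exists>A. (\<forall>i\<le>k. openin Z (A i) \<and> (\<forall>s\<in>{1..r}. \<forall>t\<in>{1..r}.
              fibrewise_homotopic (subtopology Z (A i)) (p \<circ> h) Y q (f s \<circ> h) (f t \<circ> h))) \<and>
             (\<forall>z\<in>topspace Z. m < card {i. i \<le> k \<and> z \<in> A i})"
proof -
  define P where "P W \<longleftrightarrow> (\<forall>s\<in>{1..r}. \<forall>t\<in>{1..r}.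
      fibrewise_homotopic (subtopology Z W) (p \<circ> h) Y q (f s \<circ> h) (f t \<circ> h))" for W
  define A where "A i = {z \<in> topspace Z. h z \<in> U i}" for i
  have cover: "\<And>i. i \<le> n \<Longrightarrow> openin X (U i)" "(\<Union>i\<le>n. U i) = topspace X"
    and hom: "\<And>i s t. i \<le> n \<Longrightarrow> s \<in> {1..r} \<Longrightarrow> t \<in> {1..r} \<Longrightarrow>
        fibrewise_homotopic (subtopology X (U i)) p Y q (f s) (f t)"
    using assms(2) unfolding fibrewise_homotopic_cover_def by blast+
  show ?thesis
    unfolding P_def[symmetric] unfolding k
  proof (rule normal_space_cover_extend[OF \<open>normal_space Z\<close>])
    show "P W" if "P U" "W \<subseteq> U" for U W
      using that fibrewise_homotopic_subset unfolding P_def by blast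
    show "P (\<Union>S\<in>I. W S)"
      if "\<And>S. S \<in> I \<Longrightarrow> openin Z (W S)" "\<And>S. S \<in> I \<Longrightarrow> P (W S)" "disjoint_family_on W I"
      for I :: "nat set set" and W
      unfolding P_def
    proof (intro ballI)
      fix s t assume "s \<in> {1..r}" "t \<in> {1..r}"
      then show "fibrewise_homotopic (subtopology Z (\<Union>S\<in>I. W S)) (p \<circ> h) Y q (f s \<circ> h) (f t \<circ> h)"
        using that by (intro fibrewise_homotopic_disjoint_union) (auto simp: P_def)
    qed
    show "openin Z (A i)" if "i \<le> n" for i
      unfolding A_def using openin_continuous_map_preimage[OF h cover(1)[OF that]] .
    show "P (A i)" if "i \<le> n" for i
    proof -
      have "continuous_map (subtopology Z (A i)) (subtopology X (U i)) h"
        using h by (auto simp: A_def continuous_map_in_subtopology continuous_map_from_subtopology)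
      from fibrewise_homotopic_pullback[OF hom[OF that] this, of _ _ "p \<circ> h"] show ?thesis
        unfolding P_def by simp
    qed
    show "(\<Union>i\<le>n. A i) = topspace Z"
      using cover(2) h by (fastforce simp: A_def continuous_map_def)
  qed
qed

lemma fibrewise_distance_attained:
  assumes "fibrewise_distance X p Y q r f = enat n"
  obtains U where "fibrewise_homotopic_cover X p Y q r f n U"
proof -
  let ?D = "{enat n | n. \<exists>U. fibrewise_homotopic_cover X p Y q r f n U}"
  have "?D \<noteq> {}"
    using assms unfolding fibrewise_distance_def by (metis (no_types, lifting) Inf_enat_def enat.distinct(1))
  then have "Inf ?D \<in> ?D"
    unfolding Inf_enat_def using LeastI[of "\<lambda>x. x \<in> ?D"] by auto
  then show thesis
    using assms that unfolding fibrewise_distance_def by auto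
qed

theorem proposition5p12:
  fixes B :: "'b topology"
    and X :: "'x topology" and pX :: "'x \<Rightarrow> 'b"
    and Y :: "'y topology" and pY :: "'y \<Rightarrow> 'b"
    and X' :: "'u topology" and pX' :: "'u \<Rightarrow> 'b"
    and Y' :: "'v topology" and pY' :: "'v \<Rightarrow> 'b"
    and r :: nat
    and f :: "nat \<Rightarrow> 'x \<Rightarrow> 'y" and g :: "nat \<Rightarrow> 'u \<Rightarrow> 'v"
  assumes "fibrewise_space B X pX" and "fibrewise_space B Y pY"
    and "fibrewise_space B X' pX'" and "fibrewise_space B Y' pY'"
    and "r \<ge> 1"
    and "\<And>s. s \<in> {1..r} \<Longrightarrow> fibrewise_map X pX Y pY (f s)"
    and "\<And>s. s \<in> {1..r} \<Longrightarrow> fibrewise_map X' pX' Y' pY' (g s)"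
    and "normal_space (fibrewise_product X pX X' pX')"
  shows "fibrewise_distance (fibrewise_product X pX X' pX') (fibrewise_product_proj pX)
           (fibrewise_product Y pY Y' pY') (fibrewise_product_proj pY)
           r (\<lambda>s. map_prod (f s) (g s))
         \<le> fibrewise_distance X pX Y pY r f + fibrewise_distance X' pX' Y' pY' r g"
proof (cases "fibrewise_distance X pX Y pY r f = \<infinity> \<or> fibrewise_distance X' pX' Y' pY' r g = \<infinity>")
  case True
  then show ?thesis by auto
next
  case False
  let ?Z = "fibrewise_product X pX X' pX'"
  obtain n m where n: "fibrewise_distance X pX Y pY r f = enat n"
    and m: "fibrewise_distance X' pX' Y' pY' r g = enat m"
    using False by auto
  obtain U where U: "fibrewise_homotopic_cover X pX Y pY r f n U"
    using fibrewise_distance_attained[OF n] .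
  obtain V where V: "fibrewise_homotopic_cover X' pX' Y' pY' r g m V"
    using fibrewise_distance_attained[OF m] .
  have pr: "continuous_map ?Z X fst" "continuous_map ?Z X' snd"
    unfolding fibrewise_product_def
    by (simp_all add: continuous_map_from_subtopology continuous_map_fst continuous_map_snd)
  obtain A where A: "\<And>i. i \<le> n + m \<Longrightarrow> openin ?Z (A i)"
    "\<And>i s t. i \<le> n + m \<Longrightarrow> s \<in> {1..r} \<Longrightarrow> t \<in> {1..r} \<Longrightarrow>
       fibrewise_homotopic (subtopology ?Z (A i)) (pX \<circ> fst) Y pY (f s \<circ> fst) (f t \<circ> fst)"
    "\<And>z. z \<in> topspace ?Z \<Longrightarrow> m < card {i. i \<le> n + m \<and> z \<in> A i}"
    using fibrewise_homotopic_cover_extend[OF assms(8) U pr(1) refl, of m] by blast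
  obtain C where C: "\<And>i. i \<le> n + m \<Longrightarrow> openin ?Z (C i)"
    "\<And>i s t. i \<le> n + m \<Longrightarrow> s \<in> {1..r} \<Longrightarrow> t \<in> {1..r} \<Longrightarrow>
       fibrewise_homotopic (subtopology ?Z (C i)) (pX' \<circ> snd) Y' pY' (g s \<circ> snd) (g t \<circ> snd)"
    "\<And>z. z \<in> topspace ?Z \<Longrightarrow> n < card {i. i \<le> n + m \<and> z \<in> C i}"
    using fibrewise_homotopic_cover_extend[OF assms(8) V pr(2) add.commute[of n m]] by blast
  \<comment> \<open>Pigeonhole: more than \<open>m\<close> plus more than \<open>n\<close> indices cannot be disjoint among \<open>n + m + 1\<close>.\<close>
  have meet: "\<exists>i\<le>n + m. z \<in> A i \<inter> C i" if z: "z \<in> topspace ?Z" for z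
  proof (rule ccontr)
    let ?a = "{i. i \<le> n + m \<and> z \<in> A i}" and ?c = "{i. i \<le> n + m \<and> z \<in> C i}"
    assume "\<not> ?thesis"
    then have "?a \<inter> ?c = {}" by blast
    then have "card ?a + card ?c = card (?a \<union> ?c)"
      by (simp add: card_Un_disjoint)
    also have "\<dots> \<le> card {..n + m}"
      by (rule card_mono) auto
    finally show False
      using A(3)[OF z] C(3)[OF z] by simp
  qed
  have "fibrewise_homotopic_cover ?Z (fibrewise_product_proj pX)
          (fibrewise_product Y pY Y' pY') (fibrewise_product_proj pY)
          r (\<lambda>s. map_prod (f s) (g s)) (n + m) (\<lambda>i. A i \<inter> C i)"
    unfolding fibrewise_homotopic_cover_def
  proof (intro conjI allI impI ballI)
    show "(\<Union>i\<le>n + m. A i \<inter> C i) = topspace ?Z"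
      using meet openin_subset[OF A(1)] by blast
    fix i assume i: "i \<le> n + m"
    show "openin ?Z (A i \<inter> C i)"
      using A(1) C(1) i by blast
    fix s t assume st: "s \<in> {1..r}" "t \<in> {1..r}"
    show "fibrewise_homotopic (subtopology ?Z (A i \<inter> C i)) (fibrewise_product_proj pX)
            (fibrewise_product Y pY Y' pY') (fibrewise_product_proj pY)
            (map_prod (f s) (g s)) (map_prod (f t) (g t))"
      using A(2)[OF i st] C(2)[OF i st]
      by (intro fibrewise_homotopic_map_prod) (auto elim: fibrewise_homotopic_subset)
  qed
  then have "fibrewise_distance ?Z (fibrewise_product_proj pX)
          (fibrewise_product Y pY Y' pY') (fibrewise_product_proj pY)
          r (\<lambda>s. map_prod (f s) (g s)) \<le> enat (n + m)"
    unfolding fibrewise_distance_def by (intro Inf_lower) blast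
  then show ?thesis
    by (simp add: n m)
qed

end
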